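(* Let $((X_i)_{i\in N},(C_i)_{i\in N})$ be a game in choice form such that for each $x\in X$ there exists $i\in N$ with $C_i(x_{-i})\neq\emptyset$. Assume that, for each $i\in N$, the following conditions are fulfilled: (a) $X_i$ is a nonempty, convex and compact set in a Hausdorff topological vector space $E_i$, and $C_i$ is nonempty; (b) for each $x_i\in X_i$, the set $\{x_{-i}\in X_{-i}: x_i\in C_i(x_{-i})\}\cup (X_{-i}\setminus W_i)$ is open in $X_{-i}$, where $W_i=\{x_{-i}\in X_{-i}: C_i(x_{-i})\neq\emptyset\}$; (c) $C_i(x_{-i})$ is convex or empty for each $x_{-i}\in X_{-i}$. Then the game admits an equilibrium in choice.
   Context: $N=\{1,\dots,n\}$ is a finite set of players, $X=\prod_{i\in N}X_i$, $X_{-i}=\prod_{j\neq i}X_j$ (product topologies), $x_{-i}=(x_1,\dots,x_{i-1},x_{i+1},\dots,x_n)$, and $x=(x_{-i},x_i)$. A game in choice form is a double family $((X_i)_{i\in N},(C_i)_{i\in N})$, where the $X_i$ are nonempty sets and $(C_i)_{i\in N}$ is a collection of nonempty subsets of $X$. The upper section of $C_i$ through $x_{-i}$ is $C_i(x_{-i})=\{y_i\in X_i:(x_{-i},y_i)\in C_i\}$. An element $x^*\in X$ is an equilibrium in choice if $x_i^*\in C_i(x_{-i}^* )$ for every $i\in N$ for which $C_i(x_{-i}^* )\neq\emptyset$. *)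

theory Defs
  imports "HOL-Analysis.Analysis" "HOL-Algebra.Module"
begin

text \<open>
  The spaces \<open>E\<^sub>i\<close> of a family are in general different vector spaces, so a vector space is given
  by an explicit carrier inside an ambient type: it is a module over the field of reals in the
  sense of \<open>HOL-Algebra\<close>.  (The fields for multiplication and unit in the record of a module
  are not used.)
\<close>

definition real_ring :: "real ring" where
  "real_ring = \<lparr>carrier = UNIV, mult = (*), one = 1, zero = 0, add = (+)\<rparr>"

lemma cring_real_ring: "cring real_ring"
  unfolding real_ring_def
  by (rule cringI[OF abelian_groupI Group.comm_monoidI])
     (auto simp: algebra_simps intro: exI[of _ "- _"] left_minus)

locale hausdorff_tvs =
  module real_ring E for E :: "(real, 'a) module" (structure) +
  fixes T :: "'a topology"
  assumes topspace_eq: "topspace T = carrier E"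
    and continuous_add: "continuous_map (prod_topology T T) T (\<lambda>(x, y). x \<oplus>\<^bsub>E\<^esub> y)"
    and continuous_smult: "continuous_map (prod_topology euclideanreal T) T (\<lambda>(r, x). r \<odot>\<^bsub>E\<^esub> x)"
    and Hausdorff: "Hausdorff_space T"

definition convex_in :: "(real, 'a) module \<Rightarrow> 'a set \<Rightarrow> bool" where
  "convex_in E S \<longleftrightarrow> S \<subseteq> carrier E \<and>
     (\<forall>x\<in>S. \<forall>y\<in>S. \<forall>u\<ge>0. \<forall>v\<ge>0. u + v = 1 \<longrightarrow> (u \<odot>\<^bsub>E\<^esub> x) \<oplus>\<^bsub>E\<^esub> (v \<odot>\<^bsub>E\<^esub> y) \<in> S)"

lemma hausdorff_tvs_type:
  "hausdorff_tvs \<lparr>carrier = UNIV, mult = undefined, one = undefined, zero = 0, add = (+), smult = (*\<^sub>R)\<rparr>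
     (euclidean :: 'a::real_normed_vector topology)"
proof -
  let ?E = "\<lparr>carrier = UNIV, mult = undefined, one = undefined, zero = (0::'a), add = (+), smult = (*\<^sub>R)\<rparr>"
  have ag: "abelian_group ?E"
    by (rule abelian_groupI) (auto simp: algebra_simps intro: exI[of _ "- _"] left_minus)
  have "module real_ring ?E"
    by (rule moduleI[OF cring_real_ring ag])
      (auto simp: real_ring_def algebra_simps)
  moreover have "continuous_on UNIV (\<lambda>(x::'a, y). x + y)" "continuous_on UNIV (\<lambda>(r, x::'a). r *\<^sub>R x)"
    by (auto simp: split_beta intro!: continuous_intros)
  ultimately show ?thesis
    by (auto simp: hausdorff_tvs_def hausdorff_tvs_axioms_def)
qed

lemma convex_in_type:
  "convex_in \<lparr>carrier = UNIV, mult = undefined, one = undefined, zero = 0, add = (+), smult = (*\<^sub>R)\<rparr> S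
     \<longleftrightarrow> convex (S :: 'a::real_vector set)"
  by (simp add: convex_in_def convex_def)

text \<open>
  A profile is a function \<open>x \<in> {1..n} \<rightarrow>\<^sub>E X\<close>; the product \<open>X\<^bsub>-i\<^esub>\<close> consists of functions with domain
  \<open>{1..n} - {i}\<close>, and \<open>(z, y)\<close> for \<open>z \<in> X\<^bsub>-i\<^esub>\<close> and \<open>y \<in> X i\<close> is the profile \<open>z(i := y)\<close>.
\<close>

definition profiles :: "nat \<Rightarrow> (nat \<Rightarrow> 'a set) \<Rightarrow> (nat \<Rightarrow> 'a) set" where
  "profiles n X = PiE {1..n} X"

definition profiles_without :: "nat \<Rightarrow> (nat \<Rightarrow> 'a set) \<Rightarrow> nat \<Rightarrow> (nat \<Rightarrow> 'a) set" where
  "profiles_without n X i = PiE ({1..n} - {i}) X"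

definition topology_without ::
  "nat \<Rightarrow> (nat \<Rightarrow> 'a topology) \<Rightarrow> (nat \<Rightarrow> 'a set) \<Rightarrow> nat \<Rightarrow> (nat \<Rightarrow> 'a) topology" where
  "topology_without n T X i = product_topology (\<lambda>j. subtopology (T j) (X j)) ({1..n} - {i})"

definition drop_player :: "nat \<Rightarrow> nat \<Rightarrow> (nat \<Rightarrow> 'a) \<Rightarrow> (nat \<Rightarrow> 'a)" where
  "drop_player n i x = restrict x ({1..n} - {i})"

lemma drop_player_upd:
  "x \<in> profiles n X \<Longrightarrow> i \<in> {1..n} \<Longrightarrow> (drop_player n i x)(i := x i) = x"
  by (auto simp: profiles_def drop_player_def PiE_iff extensional_def)

definition game_in_choice_form :: "nat \<Rightarrow> (nat \<Rightarrow> 'a set) \<Rightarrow> (nat \<Rightarrow> (nat \<Rightarrow> 'a) set) \<Rightarrow> bool" where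
  "game_in_choice_form n X C \<longleftrightarrow>
     (\<forall>i\<in>{1..n}. X i \<noteq> {} \<and> C i \<noteq> {} \<and> C i \<subseteq> profiles n X)"

definition upper_section ::
  "(nat \<Rightarrow> 'a set) \<Rightarrow> (nat \<Rightarrow> (nat \<Rightarrow> 'a) set) \<Rightarrow> nat \<Rightarrow> (nat \<Rightarrow> 'a) \<Rightarrow> 'a set" where
  "upper_section X C i z = {y \<in> X i. z(i := y) \<in> C i}"

definition choice_domain ::
  "nat \<Rightarrow> (nat \<Rightarrow> 'a set) \<Rightarrow> (nat \<Rightarrow> (nat \<Rightarrow> 'a) set) \<Rightarrow> nat \<Rightarrow> (nat \<Rightarrow> 'a) set" where
  "choice_domain n X C i = {z \<in> profiles_without n X i. upper_section X C i z \<noteq> {}}"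

definition equilibrium_in_choice ::
  "nat \<Rightarrow> (nat \<Rightarrow> 'a set) \<Rightarrow> (nat \<Rightarrow> (nat \<Rightarrow> 'a) set) \<Rightarrow> (nat \<Rightarrow> 'a) \<Rightarrow> bool" where
  "equilibrium_in_choice n X C x \<longleftrightarrow> x \<in> profiles n X \<and>
     (\<forall>i\<in>{1..n}. upper_section X C i (drop_player n i x) \<noteq> {} \<longrightarrow>
        x i \<in> upper_section X C i (drop_player n i x))"

end

theory Submission
  imports Defs "HOL-Homology.Simplices"
begin

text \<open>
  Let \<open>\<Phi>\<^sub>i(x) = C\<^sub>i(x\<^bsub>-i\<^esub>)\<close> if this set is nonempty and \<open>\<Phi>\<^sub>i(x) = X\<^sub>i\<close> otherwise.  The values of \<open>\<Phi>\<^sub>i\<close> are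
  nonempty and convex, and hypothesis (b) says that \<open>{x. y \<in> \<Phi>\<^sub>i(x)}\<close> is open for each \<open>y\<close>, so a fixed
  point of the product of the \<open>\<Phi>\<^sub>i\<close> exists by the Fan-Browder theorem; it is an equilibrium in choice.
  For Fan-Browder, compactness gives finitely many profiles \<open>y\<^sub>0, \<dots>, y\<^sub>m\<close> such that the open sets
  \<open>{x. y\<^sub>k \<in> \<Phi>(x)}\<close> cover \<open>X\<close>.  They are pulled back to the standard simplex along
  \<open>\<sigma>(t) = \<Sum>\<^sub>k t\<^sub>k y\<^sub>k\<close>, where Brouwer's theorem gives a point \<open>t\<close> that lies in the \<open>k\<close>-th set whenever
  \<open>t\<^sub>k > 0\<close>; then \<open>\<sigma>(t) \<in> \<Phi>(\<sigma>(t))\<close> by convexity.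
\<close>

section \<open>Brouwer's fixed point theorem on cubes\<close>

lemma tendsto_fun_iff:
  "(f \<longlongrightarrow> l) F \<longleftrightarrow> (\<forall>i. ((\<lambda>c. f c i) \<longlongrightarrow> l i) F)"
  for f :: "'a \<Rightarrow> 'b \<Rightarrow> 'c::topological_space"
  using limitin_componentwise[of "\<lambda>_. euclidean" UNIV f l F]
  by (simp add: euclidean_product_topology)

lemma compact_standard_simplex: "compact (standard_simplex m)"
  using compactin_standard_simplex[of m] by (simp add: euclidean_product_topology)

text \<open>The vanishing tail puts cubes of all dimensions into the type of
  \<open>standard_simplex\<close>, so that the dimension can be a variable.\<close>

definition standard_cube :: "nat \<Rightarrow> (nat \<Rightarrow> real) set" where
  "standard_cube n = {x. (\<forall>i<n. 0 \<le> x i \<and> x i \<le> 1) \<and> (\<forall>i\<ge>n. x i = 0)}"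

lemma compact_standard_cube: "compact (standard_cube n)"
proof -
  have "standard_cube n = (\<Pi>\<^sub>E i\<in>UNIV. if i < n then {0..1} else {0})"
    by (auto simp: standard_cube_def PiE_iff) (metis atLeastAtMost_iff leD singletonD)+
  moreover have "compactin (product_topology (\<lambda>_. euclideanreal) UNIV)
      (\<Pi>\<^sub>E i\<in>UNIV. if i < n then {0..1} else {0})"
    by (subst compactin_PiE) auto
  ultimately show ?thesis
    by (simp add: euclidean_product_topology)
qed

text \<open>
  The Brouwer theorem of the library is about a Euclidean type, whose dimension cannot be a variable
  of a proof.  The combinatorial lemma behind it has no such restriction.
\<close>

lemma Brouwer_standard_cube:
  assumes cont: "continuous_on (standard_cube n) f"
    and maps: "f ` standard_cube n \<subseteq> standard_cube n"
  obtains x where "x \<in> standard_cube n" "f x = x"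
proof -
  \<comment> \<open>Grid points of mesh \<open>1 / p\<close>. Label 0 records that \<open>f\<close>
    does not lower coordinate \<open>i\<close>, label 1 that \<open>f\<close> does not raise it.
    Kuhn's lemma demands label 0 on the face \<open>a i = 0\<close> and label 1 on the face
    \<open>a i = p\<close>; both are truthful there because \<open>f\<close> stays in the
    cube.\<close>
  define pt where "pt p a = (\<lambda>i. if i < n then real (a i) / real p else 0)" for p and a :: "nat \<Rightarrow> nat"
  define label where
    "label p a i = (if a i = p \<or> (a i \<noteq> 0 \<and> f (pt p a) i < pt p a i) then 1 else 0::nat)" for p a i
  have pt_cube: "pt p a \<in> standard_cube n" if "\<forall>i<n. a i \<le> p" for p a
    using that by (auto simp: pt_def standard_cube_def divide_le_eq_1)
  have f_pt: "0 \<le> f (pt p a) i \<and> f (pt p a) i \<le> 1" if "\<forall>i<n. a i \<le> p" "i < n" for p a i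
  proof -
    have "f (pt p a) \<in> standard_cube n"
      using maps pt_cube[OF that(1)] by blast
    then show ?thesis
      using that(2) by (simp add: standard_cube_def)
  qed
  have label_0: "pt p a i \<le> f (pt p a) i"
    if "\<forall>i<n. a i \<le> p" "i < n" "label p a i = 0" for p a i
    using that f_pt[OF that(1,2)] by (auto simp: label_def pt_def split: if_splits)
  have label_1: "f (pt p a) i \<le> pt p a i"
    if "0 < p" "\<forall>i<n. a i \<le> p" "i < n" "label p a i \<noteq> 0" for p a i
    using that f_pt[OF that(2,3)] by (auto simp: label_def pt_def split: if_splits)
  \<comment> \<open>The vertices of the grid cell with lowest corner \<open>q\<close>; the bound by
    \<open>p\<close> keeps them in the cube.\<close>
  define near where "near p q a \<longleftrightarrow> (\<forall>j<n. q j \<le> a j \<and> a j \<le> q j + 1 \<and> a j \<le> p)"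
    for p :: nat and q a :: "nat \<Rightarrow> nat"
  have "\<exists>q r s. (\<forall>i<n. q i \<le> p) \<and> (\<forall>i<n. near p q (r i) \<and> near p q (s i) \<and>
        pt p (r i) i \<le> f (pt p (r i)) i \<and> f (pt p (s i)) i \<le> pt p (s i) i)" if p: "0 < p" for p
  proof -
    obtain q where q: "\<forall>i<n. q i < p"
      and rs: "\<forall>i<n. \<exists>r s. (\<forall>j<n. q j \<le> r j \<and> r j \<le> q j + 1) \<and>
        (\<forall>j<n. q j \<le> s j \<and> s j \<le> q j + 1) \<and> label p r i \<noteq> label p s i"
      by (rule kuhn_lemma[of p n "label p"]) (use p in \<open>auto simp: label_def\<close>)
    have "\<exists>r s. near p q r \<and> near p q s \<and> pt p r i \<le> f (pt p r) i \<and> f (pt p s) i \<le> pt p s i"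
      if i: "i < n" for i
    proof -
      obtain r s where "near p q r" "near p q s" "label p r i \<noteq> label p s i"
      proof -
        obtain r s where rs': "\<forall>j<n. q j \<le> r j \<and> r j \<le> q j + 1"
          "\<forall>j<n. q j \<le> s j \<and> s j \<le> q j + 1" "label p r i \<noteq> label p s i"
          using rs i by blast
        then have "near p q r" "near p q s"
          using q unfolding near_def by (metis Suc_eq_plus1 Suc_leI le_trans)+
        then show thesis
          using that rs'(3) by blast
      qed
      \<comment> \<open>Only two labels occur, so after a possible exchange \<open>r\<close> is the
        vertex with label 0.\<close>
      then obtain r s where "near p q r" "near p q s" "label p r i = 0" "label p s i \<noteq> 0"
        by (metis (full_types) label_def)
      then show ?thesis
        using label_0[of r p i] label_1[of p s i] \<open>0 < p\<close> i unfolding near_def by blast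
    qed
    then obtain r s where "\<forall>i<n. near p q (r i) \<and> near p q (s i) \<and>
        pt p (r i) i \<le> f (pt p (r i)) i \<and> f (pt p (s i)) i \<le> pt p (s i) i"
      by metis
    then show ?thesis
      using q less_imp_le by blast
  qed
  then have "\<forall>k. \<exists>q r s. (\<forall>i<n. q i \<le> Suc k) \<and> (\<forall>i<n. near (Suc k) q (r i) \<and> near (Suc k) q (s i) \<and>
      pt (Suc k) (r i) i \<le> f (pt (Suc k) (r i)) i \<and> f (pt (Suc k) (s i)) i \<le> pt (Suc k) (s i) i)"
    by blast
  then obtain q r s where q: "\<And>k. \<forall>i<n. q k i \<le> Suc k"
    and r: "\<And>k i. i < n \<Longrightarrow> near (Suc k) (q k) (r k i)"
      "\<And>k i. i < n \<Longrightarrow> pt (Suc k) (r k i) i \<le> f (pt (Suc k) (r k i)) i"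
    and s: "\<And>k i. i < n \<Longrightarrow> near (Suc k) (q k) (s k i)"
      "\<And>k i. i < n \<Longrightarrow> f (pt (Suc k) (s k i)) i \<le> pt (Suc k) (s k i) i"
    by metis
  obtain x \<rho> where x: "x \<in> standard_cube n" and \<rho>: "strict_mono \<rho>"
    and lim: "((\<lambda>k. pt (Suc k) (q k)) \<circ> \<rho>) \<longlonglongrightarrow> x"
    using seq_compactE[OF compact_imp_seq_compact[OF compact_standard_cube[of n]],
        of "\<lambda>k. pt (Suc k) (q k)"] pt_cube q by blast
  \<comment> \<open>The cells shrink, so any choice of their vertices converges to the limit
    \<open>x\<close> of the lowest corners. One subsequence \<rho> thus serves all coordinates and
    both kinds of vertices.\<close>
  have near_lim: "(\<lambda>k. pt (Suc (\<rho> k)) (a (\<rho> k))) \<longlonglongrightarrow> x"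
      and f_near_lim: "(\<lambda>k. f (pt (Suc (\<rho> k)) (a (\<rho> k)))) \<longlonglongrightarrow> f x"
    if a: "\<And>k. near (Suc k) (q k) (a k)" for a
  proof -
    have "(\<lambda>k. pt (Suc (\<rho> k)) (a (\<rho> k)) j) \<longlonglongrightarrow> x j" for j
    proof -
      have "\<bar>pt (Suc k) (a k) j - pt (Suc k) (q k) j\<bar> \<le> 1 / real (Suc k)" for k
      proof (cases "j < n")
        case True
        then have "q k j \<le> a k j" "a k j \<le> q k j + 1"
          using a[of k] by (auto simp: near_def)
        then have "\<bar>real (a k j) - real (q k j)\<bar> \<le> 1"
          by linarith
        moreover have "pt (Suc k) (a k) j - pt (Suc k) (q k) j
            = (real (a k j) - real (q k j)) / real (Suc k)"
          using True by (simp add: pt_def diff_divide_distrib)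
        ultimately show ?thesis
          by (simp add: abs_divide divide_right_mono)
      qed (simp add: pt_def)
      then have "(\<lambda>k. pt (Suc k) (a k) j - pt (Suc k) (q k) j) \<longlonglongrightarrow> 0"
        by (intro Lim_null_comparison[OF _ LIMSEQ_inverse_real_of_nat])
          (auto simp: inverse_eq_divide)
      then have "(\<lambda>k. pt (Suc (\<rho> k)) (a (\<rho> k)) j - pt (Suc (\<rho> k)) (q (\<rho> k)) j) \<longlonglongrightarrow> 0"
        using LIMSEQ_subseq_LIMSEQ[OF _ \<rho>] by (fastforce simp: o_def)
      moreover have "(\<lambda>k. pt (Suc (\<rho> k)) (q (\<rho> k)) j) \<longlonglongrightarrow> x j"
        using lim unfolding tendsto_fun_iff by (simp add: o_def)
      ultimately show ?thesis
        using tendsto_add by fastforce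
    qed
    then show *: "(\<lambda>k. pt (Suc (\<rho> k)) (a (\<rho> k))) \<longlonglongrightarrow> x"
      by (subst tendsto_fun_iff) blast
    have "pt (Suc (\<rho> k)) (a (\<rho> k)) \<in> standard_cube n" for k
      using a[of "\<rho> k"] by (intro pt_cube) (auto simp: near_def)
    then show "(\<lambda>k. f (pt (Suc (\<rho> k)) (a (\<rho> k)))) \<longlonglongrightarrow> f x"
      by (intro continuous_on_tendsto_compose[OF cont * x]) auto
  qed
  have "f x i = x i" for i
  proof (cases "i < n")
    case True
    have "(\<lambda>k. f (pt (Suc (\<rho> k)) (r (\<rho> k) i)) i) \<longlonglongrightarrow> f x i"
      and "(\<lambda>k. f (pt (Suc (\<rho> k)) (s (\<rho> k) i)) i) \<longlonglongrightarrow> f x i"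
      and "(\<lambda>k. pt (Suc (\<rho> k)) (r (\<rho> k) i) i) \<longlonglongrightarrow> x i"
      and "(\<lambda>k. pt (Suc (\<rho> k)) (s (\<rho> k) i) i) \<longlonglongrightarrow> x i"
      using near_lim[of "\<lambda>k. r k i"] f_near_lim[of "\<lambda>k. r k i"]
        near_lim[of "\<lambda>k. s k i"] f_near_lim[of "\<lambda>k. s k i"] r(1)[OF True] s(1)[OF True]
      by (simp_all add: tendsto_fun_iff)
    \<comment> \<open>In the limit the vertices \<open>r\<close> give
      \<open>x i \<le> f x i\<close>, and the vertices \<open>s\<close> give the converse.\<close>
    then show ?thesis
      using r(2)[OF True] s(2)[OF True] by (intro antisym) (blast intro: LIMSEQ_le)+
  next
    case False
    moreover have "f x \<in> standard_cube n"
      using x maps by blast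
    ultimately show ?thesis
      using x by (simp add: standard_cube_def)
  qed
  with x show thesis
    using that by blast
qed

section \<open>Brouwer's fixed point theorem on simplices\<close>

text \<open>The simplex is homeomorphic to a retract of the cube and so inherits the fixed point
  property.\<close>

lemma Brouwer_standard_simplex:
  assumes cont: "continuous_on (standard_simplex m) f"
    and maps: "f ` standard_simplex m \<subseteq> standard_simplex m"
  obtains x where "x \<in> standard_simplex m" "f x = x"
proof -
  \<comment> \<open>\<open>h\<close> sends the cube to the simplex, with right inverse \<open>g\<close>; the last coordinate is the slack.\<close>
  define h where "h t = (let M = max 1 (\<Sum>k<m. t k) in
      (\<lambda>k. if k < m then t k / M else if k = m then 1 - (\<Sum>k<m. t k) / M else 0))" for t :: "nat \<Rightarrow> real"
  define g where "g x = (\<lambda>k. if k < m then x k else 0)" for x :: "nat \<Rightarrow> real"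
  \<comment> \<open>The divisor \<open>M\<close> caps the sum of the first \<open>m\<close>
    coordinates at 1, which leaves a nonnegative slack.\<close>
  have h_maps: "h t \<in> standard_simplex m" if t: "t \<in> standard_cube m" for t
  proof -
    let ?S = "\<Sum>k<m. t k"
    have "0 \<le> t k" for k
      using t by (cases "k < m") (auto simp: standard_cube_def)
    moreover have "t k \<le> max 1 ?S" if "k < m" for k
      using t that by (auto simp: standard_cube_def)
    moreover have "0 \<le> ?S / max 1 ?S"
      using calculation(1) by (simp add: sum_nonneg)
    ultimately show ?thesis
      by (auto simp: standard_simplex_def h_def Let_def divide_le_eq_1 field_simps
          lessThan_Suc_atMost[symmetric] sum_divide_distrib[symmetric])
  qed
  have g_maps: "g x \<in> standard_cube m" if "x \<in> standard_simplex m" for x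
    using that by (auto simp: standard_simplex_def standard_cube_def g_def)
  \<comment> \<open>On the image of \<open>g\<close> the coordinate sum is at most 1, so
    \<open>M = 1\<close> and the slack restores \<open>x m\<close>.\<close>
  have hg: "h (g x) = x" if x: "x \<in> standard_simplex m" for x
  proof -
    have "(\<Sum>k<m. x k) + x m = 1" "0 \<le> x m"
      using x by (auto simp: standard_simplex_def lessThan_Suc_atMost[symmetric])
    moreover from this have "max 1 (\<Sum>k<m. x k) = 1"
      by simp
    moreover have "x k = 0" if "k > m" for k
      using x that by (auto simp: standard_simplex_def)
    ultimately show ?thesis
      by (auto simp: h_def g_def fun_eq_iff)
  qed
  have coord: "continuous_on A (\<lambda>t. t k)" for A :: "(nat \<Rightarrow> real) set" and k
    by (rule continuous_on_subset[OF continuous_on_product_coordinates subset_UNIV])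
  have h_cont: "continuous_on A h" for A
  proof (rule continuous_on_coordinatewise_then_product)
    fix k
    have "continuous_on A (\<lambda>t. t k / max 1 (\<Sum>k<m. t k))"
      "continuous_on A (\<lambda>t. 1 - (\<Sum>k<m. t k) / max 1 (\<Sum>k<m. t k))"
      by (intro continuous_on_divide continuous_on_diff continuous_on_max continuous_on_sum
          continuous_on_const coord; simp add: max_def)+
    then show "continuous_on A (\<lambda>t. h t k)"
      by (cases "k < m"; cases "k = m") (simp_all add: h_def Let_def)
  qed
  have g_cont: "continuous_on A g" for A
    unfolding g_def
  proof (rule continuous_on_coordinatewise_then_product)
    show "continuous_on A (\<lambda>x. if k < m then x k else 0)" for k
      using coord[of A k] by (cases "k < m") simp_all
  qed
  have "continuous_on (standard_cube m) (g \<circ> f \<circ> h)"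
    by (intro continuous_on_compose h_cont g_cont continuous_on_subset[OF cont])
      (auto simp: h_maps)
  moreover have "(g \<circ> f \<circ> h) ` standard_cube m \<subseteq> standard_cube m"
    using h_maps g_maps maps by auto
  ultimately obtain t where t: "t \<in> standard_cube m" "g (f (h t)) = t"
    using Brouwer_standard_cube[of m "g \<circ> f \<circ> h"] by auto
  \<comment> \<open>Apply \<open>h\<close> to \<open>g (f (h t)) = t\<close> and cancel
    \<open>h (g _)\<close> on the simplex.\<close>
  have "f (h t) = h t"
    using hg[of "f (h t)"] h_maps[OF t(1)] maps t(2) by auto
  then show thesis
    using that h_maps[OF t(1)] by blast
qed

section \<open>Open covers of the simplex\<close>

text \<open>Weights that are positive exactly on the sets \<open>U k\<close>, normalised to sum 1,
  are the barycentric coordinates of a continuous self-map of the simplex. At a fixed point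
  \<open>t k\<close> is the \<open>k\<close>-th weight, so \<open>0 < t k\<close> forces
  \<open>t\<close> into \<open>U k\<close>.\<close>

lemma open_cover_standard_simplex:
  assumes op: "\<And>k. k \<le> m \<Longrightarrow> openin (top_of_set (standard_simplex m)) (U k)"
    and cover: "standard_simplex m \<subseteq> (\<Union>k\<le>m. U k)"
  obtains t where "t \<in> standard_simplex m" "\<And>k. k \<le> m \<Longrightarrow> 0 < t k \<Longrightarrow> t \<in> U k"
proof -
  let ?D = "standard_simplex m"
  \<comment> \<open>The case distinction is needed because \<open>infdist t {} = 0\<close>.\<close>
  define d where "d k t = (if ?D \<subseteq> U k then 1 else infdist t (?D - U k))" for k t
  have d_pos: "0 < d k t \<longleftrightarrow> t \<in> U k" if "t \<in> ?D" "k \<le> m" for t k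
  proof -
    \<comment> \<open>Distance to a set vanishes exactly on its closure; the complement is
      relatively closed in a compact set, hence closed.\<close>
    have "closed (?D - U k)"
      using op[OF that(2)] compact_standard_simplex[of m]
      by (metis closedin_closed_trans closedin_diff closedin_topspace compact_imp_closed
          topspace_euclidean_subtopology)
    then show ?thesis
      using that in_closed_iff_infdist_zero[of "?D - U k" t] infdist_nonneg[of t "?D - U k"]
      by (auto simp: d_def less_le)
  qed
  have d_nonneg: "0 \<le> d k t" for k t
    by (simp add: d_def infdist_nonneg)
  have sum_pos: "0 < (\<Sum>k\<le>m. d k t)" if t: "t \<in> ?D" for t
  proof -
    obtain k where "k \<le> m" "t \<in> U k"
      using cover t by blast
    then show ?thesis
      using t d_pos d_nonneg by (intro sum_pos2[of _ k]) auto
  qed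
  define f where "f t = (\<lambda>k. if k \<le> m then d k t / (\<Sum>k\<le>m. d k t) else 0)" for t
  have d_cont: "continuous_on ?D (d k)" for k
    unfolding d_def by (cases "?D \<subseteq> U k") (auto intro!: continuous_intros)
  have "continuous_on ?D f"
    unfolding f_def
  proof (rule continuous_on_coordinatewise_then_product)
    fix k
    have "continuous_on ?D (\<lambda>t. d k t / (\<Sum>k\<le>m. d k t))"
      by (intro continuous_intros d_cont ballI less_imp_neq[THEN not_sym] sum_pos)
    then show "continuous_on ?D (\<lambda>t. if k \<le> m then d k t / (\<Sum>k\<le>m. d k t) else 0)"
      by (cases "k \<le> m") simp_all
  qed
  moreover have "f ` ?D \<subseteq> ?D"
  proof safe
    fix t assume "t \<in> ?D"
    then have "0 < (\<Sum>k\<le>m. d k t)"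
      by (rule sum_pos)
    moreover have "d k t \<le> (\<Sum>k\<le>m. d k t)" if "k \<le> m" for k
      using that d_nonneg by (intro member_le_sum) auto
    ultimately show "f t \<in> ?D"
      using d_nonneg
      by (auto simp: f_def standard_simplex_def divide_le_eq_1 sum_divide_distrib[symmetric])
  qed
  ultimately obtain t where t: "t \<in> ?D" "f t = t"
    using Brouwer_standard_simplex by blast
  have "t \<in> U k" if "k \<le> m" "0 < t k" for k
  proof -
    have "f t k = d k t / (\<Sum>k\<le>m. d k t)"
      using that(1) by (simp add: f_def)
    then have "0 < d k t / (\<Sum>k\<le>m. d k t)"
      using that(2) t(2) by simp
    then show ?thesis
      using d_pos[OF t(1) that(1)] sum_pos[OF t(1)] by (simp add: zero_less_divide_iff)
  qed
  with t(1) show thesis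
    using that by blast
qed

section \<open>Finite linear and convex combinations in a topological vector space\<close>

lemma real_ring_simps [simp]:
  "carrier real_ring = UNIV" "a \<oplus>\<^bsub>real_ring\<^esub> b = a + b" "a \<otimes>\<^bsub>real_ring\<^esub> b = a * b"
  "\<one>\<^bsub>real_ring\<^esub> = 1" "\<zero>\<^bsub>real_ring\<^esub> = 0"
  by (simp_all add: real_ring_def)

context hausdorff_tvs
begin

lemma continuous_finsum:
  assumes "finite A" "\<And>k. k \<in> A \<Longrightarrow> continuous_map Z euclideanreal (w k)"
    and "\<And>k. k \<in> A \<Longrightarrow> y k \<in> carrier E"
  shows "continuous_map Z T (\<lambda>t. \<Oplus>\<^bsub>E\<^esub>k\<in>A. w k t \<odot>\<^bsub>E\<^esub> y k)"
  using assms
proof (induction A)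
  case empty
  then show ?case
    by (simp add: topspace_eq)
next
  case (insert a A)
  have "continuous_map Z (prod_topology euclideanreal T) (\<lambda>t. (w a t, y a))"
    using insert.prems by (simp add: continuous_map_paired topspace_eq)
  from continuous_map_compose[OF this continuous_smult]
  have "continuous_map Z T (\<lambda>t. w a t \<odot>\<^bsub>E\<^esub> y a)"
    by (simp add: o_def)
  then have "continuous_map Z (prod_topology T T)
      (\<lambda>t. (w a t \<odot>\<^bsub>E\<^esub> y a, \<Oplus>\<^bsub>E\<^esub>k\<in>A. w k t \<odot>\<^bsub>E\<^esub> y k))"
    using insert by (simp add: continuous_map_paired)
  from continuous_map_compose[OF this continuous_add] insert show ?case
    by (simp add: o_def Pi_def)
qed

text \<open>Induction splits off one point and rescales the remaining weights to sum 1, which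
  reduces to combinations of two points. Only points of positive weight are asked to lie in
  \<open>S\<close>: in the Fan-Browder argument the others may lie outside.\<close>

lemma convex_in_finsum:
  assumes "convex_in E S" "finite A" "\<And>k. k \<in> A \<Longrightarrow> y k \<in> carrier E"
    and "\<And>k. k \<in> A \<Longrightarrow> 0 \<le> w k" "(\<Sum>k\<in>A. w k) = 1"
    and "\<And>k. k \<in> A \<Longrightarrow> 0 < w k \<Longrightarrow> y k \<in> S"
  shows "(\<Oplus>\<^bsub>E\<^esub>k\<in>A. w k \<odot>\<^bsub>E\<^esub> y k) \<in> S"
  using assms(2-)
proof (induction A arbitrary: w)
  case empty
  then show ?case by simp
next
  case (insert a A)
  have S: "S \<subseteq> carrier E"
    using assms(1) by (simp add: convex_in_def)
  have yA: "y \<in> A \<rightarrow> carrier E" "y a \<in> carrier E"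
    using insert.prems(1) by auto
  have insert_eq: "(\<Oplus>\<^bsub>E\<^esub>k\<in>insert a A. w k \<odot>\<^bsub>E\<^esub> y k)
      = w a \<odot>\<^bsub>E\<^esub> y a \<oplus>\<^bsub>E\<^esub> (\<Oplus>\<^bsub>E\<^esub>k\<in>A. w k \<odot>\<^bsub>E\<^esub> y k)"
    using insert.hyps yA by (subst finsum_insert) (auto simp: Pi_iff)
  have sum_A: "(\<Sum>k\<in>A. w k) = 1 - w a"
    using insert by simp
  show ?case
  \<comment> \<open>Here the remaining weights all vanish and cannot be rescaled; the sum is
    \<open>y a\<close> itself.\<close>
  proof (cases "w a = 1")
    case True
    have "w k = 0" if "k \<in> A" for k
      using sum_A True that insert.prems(2) insert.hyps(1) by (simp add: sum_nonneg_eq_0_iff)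
    then have "(\<Oplus>\<^bsub>E\<^esub>k\<in>A. w k \<odot>\<^bsub>E\<^esub> y k) = (\<Oplus>\<^bsub>E\<^esub>k\<in>A. \<zero>\<^bsub>E\<^esub>)"
      using yA smult_l_null by (intro finsum_cong') (auto simp: Pi_iff)
    then show ?thesis
      using True yA smult_one insert.prems(4)[of a] by (auto simp: insert_eq)
  next
    case False
    have "0 \<le> (\<Sum>k\<in>A. w k)"
      using insert.prems(2) by (simp add: sum_nonneg)
    then have less: "w a < 1"
      using False sum_A by simp
    let ?v = "\<lambda>k. w k / (1 - w a)"
    have "(\<Sum>k\<in>A. ?v k) = 1"
      using sum_A less by (simp add: sum_divide_distrib[symmetric])
    then have IH: "(\<Oplus>\<^bsub>E\<^esub>k\<in>A. ?v k \<odot>\<^bsub>E\<^esub> y k) \<in> S"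
      using insert.prems less by (intro insert.IH) (auto simp: zero_less_divide_iff)
    have "(1 - w a) \<odot>\<^bsub>E\<^esub> (\<Oplus>\<^bsub>E\<^esub>k\<in>A. ?v k \<odot>\<^bsub>E\<^esub> y k)
        = (\<Oplus>\<^bsub>E\<^esub>k\<in>A. (1 - w a) \<odot>\<^bsub>E\<^esub> (?v k \<odot>\<^bsub>E\<^esub> y k))"
      using insert.hyps yA by (intro finsum_smult_ldistr) (auto simp: Pi_iff)
    also have "\<dots> = (\<Oplus>\<^bsub>E\<^esub>k\<in>A. w k \<odot>\<^bsub>E\<^esub> y k)"
      using yA less smult_assoc1[of "1 - w a" "?v _" "y _", symmetric]
      by (intro finsum_cong') (auto simp: Pi_iff)
    finally have scale: "(1 - w a) \<odot>\<^bsub>E\<^esub> (\<Oplus>\<^bsub>E\<^esub>k\<in>A. ?v k \<odot>\<^bsub>E\<^esub> y k) = (\<Oplus>\<^bsub>E\<^esub>k\<in>A. w k \<odot>\<^bsub>E\<^esub> y k)" .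
    show ?thesis
    \<comment> \<open>With weight 0, \<open>y a\<close> may lie outside \<open>S\<close>, so
      convexity cannot be applied to it.\<close>
    proof (cases "w a = 0")
      case True
      then show ?thesis
        using IH scale yA smult_l_null[of "y a"] S by (auto simp: insert_eq)
    next
      case False
      then have "0 < w a" "y a \<in> S"
        using insert.prems(2)[of a] insert.prems(4)[of a] by auto
      then have "w a \<odot>\<^bsub>E\<^esub> y a \<oplus>\<^bsub>E\<^esub> (1 - w a) \<odot>\<^bsub>E\<^esub> (\<Oplus>\<^bsub>E\<^esub>k\<in>A. ?v k \<odot>\<^bsub>E\<^esub> y k) \<in> S"
        using assms(1) IH less unfolding convex_in_def by simp
      then show ?thesis
        by (simp add: insert_eq scale)
    qed
  qed
qed

end

section \<open>The Fan-Browder theorem for products\<close>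

text \<open>The factors lie in different vector spaces, so convex combinations of profiles are
  formed coordinatewise, with the same weights in every coordinate.\<close>

lemma Fan_Browder_product:
  fixes E :: "'i \<Rightarrow> (real, 'a) module"
  assumes I: "finite I"
    and tvs: "\<And>i. i \<in> I \<Longrightarrow> hausdorff_tvs (E i) (T i)"
    and X: "\<And>i. i \<in> I \<Longrightarrow> X i \<noteq> {} \<and> convex_in (E i) (X i) \<and> compactin (T i) (X i)"
    and \<Phi>: "\<And>i x. i \<in> I \<Longrightarrow> x \<in> PiE I X \<Longrightarrow> \<Phi> i x \<noteq> {} \<and> \<Phi> i x \<subseteq> X i \<and> convex_in (E i) (\<Phi> i x)"
    and op: "\<And>i y. i \<in> I \<Longrightarrow> y \<in> X i \<Longrightarrow>
      openin (product_topology (\<lambda>j. subtopology (T j) (X j)) I) {x \<in> PiE I X. y \<in> \<Phi> i x}"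
  obtains x where "x \<in> PiE I X" "\<And>i. i \<in> I \<Longrightarrow> x i \<in> \<Phi> i x"
proof -
  let ?P = "product_topology (\<lambda>j. subtopology (T j) (X j)) I"
  have X_carrier: "X i \<subseteq> carrier (E i)" and top_Int: "topspace (T i) \<inter> X i = X i" if "i \<in> I" for i
    using X[OF that] compactin_subset_topspace[of "T i" "X i"] by (auto simp: convex_in_def)
  have top: "topspace ?P = PiE I X"
    using top_Int by (auto simp: PiE_iff)
  have compact: "compact_space ?P"
    using X by (auto simp: compact_space_product_topology compactin_subspace)
  define V where "V y = {x \<in> PiE I X. \<forall>i\<in>I. y i \<in> \<Phi> i x}" for y
  have V_open: "openin ?P (V y)" if y: "y \<in> PiE I X" for y
  proof -
    \<comment> \<open>Intersecting with the whole space gives the right set also for empty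
      \<open>I\<close>.\<close>
    have "openin ?P ((\<Inter>i\<in>I. {x \<in> PiE I X. y i \<in> \<Phi> i x}) \<inter> topspace ?P)"
      using I op y by (intro openin_INT) (auto simp: PiE_iff)
    moreover have "(\<Inter>i\<in>I. {x \<in> PiE I X. y i \<in> \<Phi> i x}) \<inter> topspace ?P = V y"
      unfolding top by (auto simp: V_def)
    ultimately show ?thesis
      by simp
  qed
  have V_cover: "\<exists>y\<in>PiE I X. x \<in> V y" if x: "x \<in> PiE I X" for x
  proof -
    define y where "y i = (SOME v. v \<in> \<Phi> i x)" for i
    have "y i \<in> \<Phi> i x" if "i \<in> I" for i
      using \<Phi>[OF that x] by (simp add: y_def some_in_eq)
    then have "restrict y I \<in> PiE I X" "x \<in> V (restrict y I)"
      using x \<Phi>[OF _ x] by (auto simp: V_def)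
    then show ?thesis
      by blast
  qed
  obtain \<F> where "finite \<F>" "\<F> \<subseteq> V ` PiE I X" "topspace ?P \<subseteq> \<Union>\<F>"
  proof -
    have "(\<forall>U\<in>V ` PiE I X. openin ?P U) \<and> topspace ?P \<subseteq> \<Union>(V ` PiE I X)"
      unfolding top using V_open V_cover by blast
    with compact show thesis
      using that unfolding compact_space_alt by (metis (no_types, lifting))
  qed
  then obtain Y where Y: "Y \<subseteq> PiE I X" "finite Y" "PiE I X \<subseteq> \<Union>(V ` Y)"
    unfolding top by (metis finite_subset_image)
  \<comment> \<open>The simplex \<open>standard_simplex m\<close> has \<open>m + 1\<close> vertices,
    one for each element of \<open>Y\<close>; such an \<open>m\<close> exists because
    \<open>Y\<close> is nonempty.\<close>
  have "PiE I X \<noteq> {}"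
    using X by (simp add: PiE_eq_empty_iff)
  with Y have "card Y \<noteq> 0"
    by auto
  then obtain m where m: "card Y = Suc m"
    using not0_implies_Suc by blast
  obtain ys where "bij_betw ys {0..<card Y} Y"
    using ex_bij_betw_nat_finite Y(2) by blast
  then have Y_eq: "Y = ys ` {..m}"
    unfolding m by (metis bij_betw_imp_surj_on atLeast0_lessThan_Suc atLeast0LessThan lessThan_Suc_atMost)
  have ys: "ys k \<in> PiE I X" if "k \<le> m" for k
    using that Y(1) Y_eq by auto
  then have ys_carrier: "ys k i \<in> carrier (E i)" if "k \<le> m" "i \<in> I" for k i
    using that X_carrier by (fastforce simp: PiE_iff)
  define \<sigma> where "\<sigma> t = (\<lambda>i\<in>I. \<Oplus>\<^bsub>E i\<^esub>k\<in>{..m}. t k \<odot>\<^bsub>E i\<^esub> ys k i)" for t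
  let ?D = "standard_simplex m"
  \<comment> \<open>Used twice: with \<open>S = X i\<close> to see that \<sigma> maps into the
    product, and with \<open>S = \<Phi> i (\<sigma> t)\<close> at the point \<open>t\<close> found
    below.\<close>
  have \<sigma>_convex: "\<sigma> t i \<in> S"
    if "t \<in> ?D" "i \<in> I" "convex_in (E i) S" "\<And>k. k \<le> m \<Longrightarrow> 0 < t k \<Longrightarrow> ys k i \<in> S" for t i S
    using that ys_carrier hausdorff_tvs.convex_in_finsum[OF tvs[OF that(2)] that(3), of "{..m}" "\<lambda>k. ys k i" t]
    by (simp add: \<sigma>_def standard_simplex_def)
  have \<sigma>_X: "\<sigma> t \<in> PiE I X" if t: "t \<in> ?D" for t
  proof (rule PiE_I)
    fix i assume "i \<in> I"
    then show "\<sigma> t i \<in> X i"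
      using \<sigma>_convex[OF t] X ys by (simp add: PiE_iff)
  qed (simp add: \<sigma>_def)
  have "continuous_map (top_of_set ?D) ?P \<sigma>"
    unfolding continuous_map_componentwise
  proof (intro conjI ballI)
    show "\<sigma> ` topspace (top_of_set ?D) \<subseteq> extensional I"
      by (auto simp: \<sigma>_def)
    fix i assume i: "i \<in> I"
    have "continuous_map (top_of_set ?D) euclideanreal (\<lambda>t. t k)" for k
      using continuous_on_subset[OF continuous_on_product_coordinates subset_UNIV] by auto
    then have "continuous_map (top_of_set ?D) (T i) (\<lambda>t. \<sigma> t i)"
      using hausdorff_tvs.continuous_finsum[OF tvs[OF i], of "{..m}" "top_of_set ?D" "\<lambda>k t. t k" "\<lambda>k. ys k i"]
        ys_carrier i by (simp add: \<sigma>_def)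
    then show "continuous_map (top_of_set ?D) (subtopology (T i) (X i)) (\<lambda>t. \<sigma> t i)"
      using \<sigma>_X i by (auto simp: continuous_map_in_subtopology)
  qed
  then have "openin (top_of_set ?D) {t \<in> ?D. \<sigma> t \<in> V (ys k)}" if "k \<le> m" for k
    using openin_continuous_map_preimage V_open[OF ys[OF that]] by fastforce
  moreover have "?D \<subseteq> (\<Union>k\<le>m. {t \<in> ?D. \<sigma> t \<in> V (ys k)})"
    using \<sigma>_X Y(3) unfolding Y_eq by fastforce
  ultimately obtain t where t: "t \<in> ?D"
    "\<And>k. k \<le> m \<Longrightarrow> 0 < t k \<Longrightarrow> t \<in> {t \<in> ?D. \<sigma> t \<in> V (ys k)}"
    using open_cover_standard_simplex[of m "\<lambda>k. {t \<in> ?D. \<sigma> t \<in> V (ys k)}"] by blast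
  have "\<sigma> t i \<in> \<Phi> i (\<sigma> t)" if i: "i \<in> I" for i
    using \<Phi>[OF i \<sigma>_X[OF t(1)]] t(2) i
    by (intro \<sigma>_convex[OF t(1) i]) (auto simp: V_def)
  with \<sigma>_X[OF t(1)] show thesis
    using that by blast
qed

section \<open>Equilibria in choice as fixed points\<close>

theorem theorem5:
  fixes n :: nat
    and E :: "nat \<Rightarrow> (real, 'a) module"
    and T :: "nat \<Rightarrow> 'a topology"
    and X :: "nat \<Rightarrow> 'a set"
    and C :: "nat \<Rightarrow> (nat \<Rightarrow> 'a) set"
  assumes game: "game_in_choice_form n X C"
    and some_choice: "\<And>x. x \<in> profiles n X \<Longrightarrow>
      \<exists>i\<in>{1..n}. upper_section X C i (drop_player n i x) \<noteq> {}"
    and a_space: "\<And>i. i \<in> {1..n} \<Longrightarrow> hausdorff_tvs (E i) (T i)"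
    and a_set: "\<And>i. i \<in> {1..n} \<Longrightarrow> X i \<noteq> {} \<and> convex_in (E i) (X i) \<and> compactin (T i) (X i)"
    and a_choice: "\<And>i. i \<in> {1..n} \<Longrightarrow> C i \<noteq> {}"
    and b: "\<And>i y. i \<in> {1..n} \<Longrightarrow> y \<in> X i \<Longrightarrow>
      openin (topology_without n T X i)
        ({z \<in> profiles_without n X i. y \<in> upper_section X C i z} \<union> (profiles_without n X i - choice_domain n X C i))"
    and c: "\<And>i z. i \<in> {1..n} \<Longrightarrow> z \<in> profiles_without n X i \<Longrightarrow>
      convex_in (E i) (upper_section X C i z) \<or> upper_section X C i z = {}"
  shows "\<exists>x. equilibrium_in_choice n X C x"
proof -
  define \<Phi> where "\<Phi> i x = (let S = upper_section X C i (drop_player n i x)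
      in if S = {} then X i else S)" for i x
  let ?P = "product_topology (\<lambda>j. subtopology (T j) (X j)) {1..n}"
  have "topspace (T i) \<inter> X i = X i" if "i \<in> {1..n}" for i
    using a_set[OF that] compactin_subset_topspace[of "T i" "X i"] by blast
  then have top: "topspace ?P = PiE {1..n} X"
    unfolding topspace_product_topology by (intro PiE_cong) simp
  have drop: "drop_player n i x \<in> profiles_without n X i" if "x \<in> PiE {1..n} X" for i x
    using that by (auto simp: drop_player_def profiles_without_def)
  obtain x where x: "x \<in> PiE {1..n} X" "\<And>i. i \<in> {1..n} \<Longrightarrow> x i \<in> \<Phi> i x"
  proof (rule Fan_Browder_product[of "{1..n}" E T X \<Phi>])
    fix i x assume i: "i \<in> {1..n}" and x: "x \<in> PiE {1..n} X"
    show "\<Phi> i x \<noteq> {} \<and> \<Phi> i x \<subseteq> X i \<and> convex_in (E i) (\<Phi> i x)"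
      using a_set[OF i] c[OF i drop[OF x]] by (auto simp: \<Phi>_def Let_def upper_section_def)
  next
    fix i y assume i: "i \<in> {1..n}" and y: "y \<in> X i"
    let ?B = "{z \<in> profiles_without n X i. y \<in> upper_section X C i z} \<union>
      (profiles_without n X i - choice_domain n X C i)"
    \<comment> \<open>Hypothesis (b) concerns the product without factor \<open>i\<close>; openness
      is pulled back along the projection.\<close>
    have "continuous_map ?P (topology_without n T X i) (drop_player n i)"
      unfolding topology_without_def continuous_map_componentwise
      by (auto simp: drop_player_def intro: continuous_map_product_projection)
    then have "openin ?P {x \<in> topspace ?P. drop_player n i x \<in> ?B}"
      using b[OF i y] by (rule openin_continuous_map_preimage)
    \<comment> \<open>Off the choice domain \<open>\<Phi> i x\<close> is all of \<open>X i\<close>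
      and contains \<open>y\<close>, which accounts for the second set of the union.\<close>
    moreover have "{x \<in> topspace ?P. drop_player n i x \<in> ?B} = {x \<in> PiE {1..n} X. y \<in> \<Phi> i x}"
      unfolding top using drop y by (auto simp: \<Phi>_def Let_def choice_domain_def)
    ultimately show "openin ?P {x \<in> PiE {1..n} X. y \<in> \<Phi> i x}"
      by simp
  qed (use a_space a_set in auto)
  then have "equilibrium_in_choice n X C x"
    unfolding equilibrium_in_choice_def profiles_def \<Phi>_def Let_def by (metis (full_types))
  then show ?thesis
    by blast
qed

end
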